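(* Let $(\mathcal{B},\mu)$ be a strictly positive atomless normalized measure algebra. For $a,b\in\mathcal{B}$ define $D(a,b):=\sup_{c\in\mathcal{B}}|\mu(a\wedge c)-\mu(b\wedge c)|$. Then for all $a,b\in\mathcal{B}$, $$D(a,b)=\max\{\mu(a\setminus b),\mu(b\setminus a)\}=\frac{\mu(a\triangle b)+|\mu(a)-\mu(b)|}{2}.$$ In particular, if $\mu(a)=\mu(b)$, then $D(a,b)=\mu(a\triangle b)/2$.
   Context: A strictly positive atomless normalized measure algebra $(\mathcal{B},\mu)$ is a Dedekind $\sigma$-complete Boolean algebra $\mathcal{B}$ with a countably additive $\mu:\mathcal{B}\to[0,1]$ such that $\mu(1)=1$, $\mu(a)>0$ for every $a\neq 0$, and $\mathcal{B}$ has no atoms. Notation: $a\setminus b=a\wedge b^c$ and $a\triangle b=(a\setminus b)\vee(b\setminus a)$. *)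

theory Defs
  imports Complex_Main "HOL-Library.Countable_Complete_Lattices"
begin

unbundle lattice_syntax

definition atom :: "'a::boolean_algebra \<Rightarrow> bool" where
  "atom a \<longleftrightarrow> a \<noteq> \<bottom> \<and> (\<forall>b\<le>a. b = \<bottom> \<or> b = a)"

definition symm_diff :: "'a::boolean_algebra \<Rightarrow> 'a \<Rightarrow> 'a" where
  "symm_diff a b = (a - b) \<squnion> (b - a)"

text \<open>
  Dedekind \<open>\<sigma>\<close>-completeness is expressed by the sort: in the class
  \<^class>\<open>countable_complete_lattice\<close>, \<^const>\<open>Sup\<close> and \<^const>\<open>Inf\<close> are constrained on countable
  sets only, and in a Boolean algebra every set is bounded by \<open>\<bottom>\<close> and \<open>\<top>\<close>.
\<close>

locale strictly_positive_atomless_measure_algebra =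
  fixes \<mu> :: "'a::{boolean_algebra, countable_complete_lattice} \<Rightarrow> real"
  assumes measure_range: "\<mu> a \<in> {0..1}"
    and countably_additive:
      "(\<And>i j. i \<noteq> j \<Longrightarrow> A i \<sqinter> A j = \<bottom>) \<Longrightarrow> (\<lambda>i::nat. \<mu> (A i)) sums \<mu> (\<Squnion>i. A i)"
    and normalized: "\<mu> \<top> = 1"
    and strictly_positive: "a \<noteq> \<bottom> \<Longrightarrow> \<mu> a > 0"
    and atomless: "\<not> atom a"

text \<open>
  For \<open>\<mu>\<close> with values in \<open>[0,1]\<close> the supremum below is that of a nonempty bounded set of reals.
\<close>

definition D :: "('a::boolean_algebra \<Rightarrow> real) \<Rightarrow> 'a \<Rightarrow> 'a \<Rightarrow> real" where
  "D \<mu> a b = (\<Squnion>c. \<bar>\<mu> (a \<sqinter> c) - \<mu> (b \<sqinter> c)\<bar>)"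

end

theory Submission
  imports Defs
begin

text \<open>Removing the part under \<open>a \<sqinter> b \<sqinter> c\<close> from both terms
  (\<open>mu_inf_diff\<close>) leaves a difference of a number in [0, s] and a number in [0, t],
  where s = \<open>\<mu> (a - b)\<close> and t = \<open>\<mu> (b - a)\<close>. Its absolute value is
  at most max s t, and disjointness of the two differences makes c = \<open>a - b\<close> and c =
  \<open>b - a\<close> attain s and t; hence \<open>D_eq_max\<close>. The second formula is max s t
  = (s + t + |s - t|) / 2, with s + t and s - t supplied by \<open>mu_symm_diff\<close> and
  \<open>mu_diff\<close>.\<close>

context strictly_positive_atomless_measure_algebra
begin

lemma nonneg: "0 \<le> \<mu> a"
  using measure_range[of a] by simp

text \<open>The constant sequence \<open>\<bottom>\<close> is pairwise disjoint, and a convergent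
  constant series has zero terms.\<close>

lemma mu_bot: "\<mu> \<bottom> = 0"
proof -
  have "summable (\<lambda>i::nat. \<mu> \<bottom>)"
    using countably_additive[of "\<lambda>_. \<bottom>"] by (auto intro: sums_summable)
  then show ?thesis by (simp add: summable_const_iff)
qed

text \<open>Countable additivity for the sequence x, y padded with \<open>\<bottom>\<close>, whose
  series has only two possibly nonzero terms.\<close>

lemma additive:
  assumes "x \<sqinter> y = \<bottom>"
  shows "\<mu> (x \<squnion> y) = \<mu> x + \<mu> y"
proof -
  define A where "A = (\<lambda>i::nat. if i = 0 then x else if i = 1 then y else \<bottom>)"
  have "range A = {x, y, \<bottom>}"
  proof
    show "{x, y, \<bottom>} \<subseteq> range A"
      using range_eqI[of x A 0] range_eqI[of y A 1] range_eqI[of \<bottom> A 2] by (auto simp: A_def)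
  qed (auto simp: A_def)
  then have "(\<Squnion>i. A i) = x \<squnion> y" by simp
  moreover have "(\<lambda>i. \<mu> (A i)) sums \<mu> (\<Squnion>i. A i)"
    by (rule countably_additive) (use assms in \<open>auto simp: A_def inf_commute\<close>)
  moreover have "(\<lambda>i. \<mu> (A i)) sums (\<Sum>i\<in>{0, 1}. \<mu> (A i))"
    by (rule sums_finite) (auto simp: A_def mu_bot)
  ultimately show ?thesis
    by (auto simp: A_def dest: sums_unique2)
qed

lemma mu_split: "\<mu> x = \<mu> (x \<sqinter> y) + \<mu> (x \<sqinter> - y)"
proof -
  have "(x \<sqinter> y) \<squnion> (x \<sqinter> - y) = x" by (simp flip: inf_sup_distrib1)
  moreover have "(x \<sqinter> y) \<sqinter> (x \<sqinter> - y) = \<bottom>"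
    by (simp add: inf_assoc inf_left_commute[of _ x])
  ultimately show ?thesis using additive by metis
qed

lemma mu_inf_le: "\<mu> (x \<sqinter> c) \<le> \<mu> x"
  using mu_split[of x c] nonneg by simp

text \<open>The common part \<open>a \<sqinter> b \<sqinter> c\<close> cancels.\<close>

lemma mu_inf_diff:
  "\<mu> (a \<sqinter> c) - \<mu> (b \<sqinter> c) = \<mu> ((a - b) \<sqinter> c) - \<mu> ((b - a) \<sqinter> c)"
  using mu_split[of "a \<sqinter> c" b] mu_split[of "b \<sqinter> c" a]
  by (simp add: diff_eq inf.assoc inf.commute inf.left_commute)

lemma mu_diff: "\<mu> a - \<mu> b = \<mu> (a - b) - \<mu> (b - a)"
  using mu_inf_diff[of a \<top> b] by simp

lemma diff_disjoint: "(a - b) \<sqinter> (b - a) = (\<bottom>::'a)"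
  by (simp add: diff_eq inf_assoc inf_left_commute[of "- b" b])

lemma mu_symm_diff: "\<mu> (symm_diff a b) = \<mu> (a - b) + \<mu> (b - a)"
  unfolding symm_diff_def by (rule additive[OF diff_disjoint])

lemma D_eq_max: "D \<mu> a b = max (\<mu> (a - b)) (\<mu> (b - a))"
  unfolding D_def
proof (rule cSup_eq_maximum)
  let ?f = "\<lambda>c. \<bar>\<mu> (a \<sqinter> c) - \<mu> (b \<sqinter> c)\<bar>"
  \<comment> \<open>For c = \<open>a - b\<close> the first term of \<open>mu_inf_diff\<close> is all
    of \<open>\<mu> (a - b)\<close> and the second vanishes; c = \<open>b - a\<close> swaps the
    roles.\<close>
  have "?f (a - b) = \<mu> (a - b)" "?f (b - a) = \<mu> (b - a)"
    unfolding mu_inf_diff[of a _ b]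
    using diff_disjoint[of a b] diff_disjoint[of b a] nonneg by (simp_all add: mu_bot)
  then have "\<mu> (a - b) \<in> range ?f" "\<mu> (b - a) \<in> range ?f"
    using rangeI[of ?f "a - b"] rangeI[of ?f "b - a"] by (simp_all only:)
  then show "max (\<mu> (a - b)) (\<mu> (b - a)) \<in> range ?f"
    unfolding max_def by presburger
  fix x assume "x \<in> range ?f"
  then obtain c where "x = \<bar>\<mu> ((a - b) \<sqinter> c) - \<mu> ((b - a) \<sqinter> c)\<bar>"
    by (auto simp: mu_inf_diff[of a _ b])
  \<comment> \<open>Two nonnegative numbers differ by at most the larger one, and
    \<open>mu_inf_le\<close> bounds each.\<close>
  then show "x \<le> max (\<mu> (a - b)) (\<mu> (b - a))"
    using mu_inf_le[of "a - b" c] mu_inf_le[of "b - a" c]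
      nonneg[of "(a - b) \<sqinter> c"] nonneg[of "(b - a) \<sqinter> c"] by linarith
qed

end

theorem proposition2:
  fixes \<mu> :: "'a::{boolean_algebra, countable_complete_lattice} \<Rightarrow> real"
    and a b :: 'a
  assumes "strictly_positive_atomless_measure_algebra \<mu>"
  shows "D \<mu> a b = max (\<mu> (a - b)) (\<mu> (b - a)) \<and>
    max (\<mu> (a - b)) (\<mu> (b - a)) = (\<mu> (symm_diff a b) + \<bar>\<mu> a - \<mu> b\<bar>) / 2 \<and>
    (\<mu> a = \<mu> b \<longrightarrow> D \<mu> a b = \<mu> (symm_diff a b) / 2)"
proof -
  interpret strictly_positive_atomless_measure_algebra \<mu> by fact
  \<comment> \<open>After rewriting, both sides involve only s and t, and the claim is the identity
    for the maximum of two reals.\<close>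
  have "max (\<mu> (a - b)) (\<mu> (b - a)) = (\<mu> (symm_diff a b) + \<bar>\<mu> a - \<mu> b\<bar>) / 2"
    unfolding mu_symm_diff mu_diff[of a b] by (simp add: max_def field_simps)
  then show ?thesis by (simp add: D_eq_max)
qed

end
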